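(* Let $m,n\ge 2$ be integers. The set $\mathcal{R}_0$ of all R$_0$-tensors is generic in $\mathbb{R}^{[m,n]}$.
   Context: $\mathbb{R}^{[m,n]}\cong\mathbb{R}^{n^m}$ is the real vector space of real $m$-th order $n$-dimensional tensors $\mathcal{A}=(a_{i_1\cdots i_m})$, $i_j\in[n]=\{1,\dots,n\}$. For $x\in\mathbb{R}^n$, $\mathcal{A}x^{m-1}\in\mathbb{R}^n$ has components $(\mathcal{A}x^{m-1})_i=\sum_{i_2,\dots,i_m=1}^n a_{ii_2\cdots i_m}x_{i_2}\cdots x_{i_m}$, and $\mathcal{A}x^m=\langle x,\mathcal{A}x^{m-1}\rangle$. For $a\in\mathbb{R}^n$, $\mathrm{Sol}(\mathcal{A},a)$ is the solution set of the tensor complementarity problem $\mathrm{TCP}(\mathcal{A},a)$, i.e. the set of $x\in\mathbb{R}^n$ with $x\ge 0$, $\mathcal{A}x^{m-1}+a\ge 0$, $\mathcal{A}x^m+\langle x,a\rangle=0$ (inequalities componentwise). $\mathcal{A}$ is an R$_0$-tensor if $\mathrm{Sol}(\mathcal{A},0)=\{0\}$; $\mathcal{R}_0\subset\mathbb{R}^{[m,n]}$ is the set of all R$_0$-tensors. A subset of $\mathbb{R}^N$ is semi-algebraic if it is a finite union of sets of the form $\{x: f_1(x)=\dots=f_\ell(x)=0,\ g_{\ell+1}(x)<0,\dots,g_k(x)<0\}$ with $f_i,g_j$ real polynomials. A semi-algebraic set $S\subset\mathbb{R}^N$ is generic if it satisfies one of the following properties, which are equivalent for semi-algebraic sets: $S$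 is dense in $\mathbb{R}^N$; $\mathbb{R}^N\setminus S$ has Lebesgue measure zero; $\dim(\mathbb{R}^N\setminus S)<N$. *)

theory Defs
  imports "HOL-Analysis.Analysis"
begin

text \<open>
  The index set \<open>[n]\<close> is a finite type \<open>'n\<close>, and the set \<open>[m]\<close> of tensor slots is a finite
  linearly ordered type \<open>'m\<close>, so that \<open>m = CARD('m)\<close> and \<open>n = CARD('n)\<close>. A multi-index
  \<open>(i\<^sub>1, \<dots>, i\<^sub>m)\<close> is a function \<open>'m \<Rightarrow> 'n\<close>. The order on \<open>'m\<close> serves only to single out the
  first slot.
\<close>

type_synonym ('m, 'n) tensor = "real ^ ('m \<Rightarrow> 'n)"

definition first_slot :: "'m::{finite,linorder}" where
  "first_slot = Min UNIV"

text \<open>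
  \<open>\<A> x\<^sup>m\<^sup>-\<^sup>1\<close>: summing over \<open>i\<^sub>2, \<dots>, i\<^sub>m\<close> with \<open>i\<^sub>1 = i\<close> fixed is summing over
  all multi-indices whose first entry is \<open>i\<close>.
\<close>

definition tensor_apply ::
  "('m::{finite,linorder}, 'n::finite) tensor \<Rightarrow> real ^ 'n \<Rightarrow> real ^ 'n" where
  "tensor_apply A x =
     (\<chi> i. \<Sum>\<iota> | \<iota> first_slot = i. A $ \<iota> * (\<Prod>j \<in> UNIV - {first_slot}. x $ \<iota> j))"

definition tensor_form ::
  "('m::{finite,linorder}, 'n::finite) tensor \<Rightarrow> real ^ 'n \<Rightarrow> real" where
  "tensor_form A x = x \<bullet> tensor_apply A x"

definition TCP_Sol ::
  "('m::{finite,linorder}, 'n::finite) tensor \<Rightarrow> real ^ 'n \<Rightarrow> (real ^ 'n) set" where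
  "TCP_Sol A a = {x. (\<forall>i. x $ i \<ge> 0) \<and> (\<forall>i. (tensor_apply A x + a) $ i \<ge> 0)
                    \<and> tensor_form A x + x \<bullet> a = 0}"

definition R0_tensors :: "('m::{finite,linorder}, 'n::finite) tensor set" where
  "R0_tensors = {A. TCP_Sol A 0 = {0}}"

definition basic_semialgebraic :: "'a::euclidean_space set \<Rightarrow> bool" where
  "basic_semialgebraic S \<longleftrightarrow>
     (\<exists>F G. finite F \<and> finite G \<and> (\<forall>f \<in> F \<union> G. real_polynomial_function f) \<and>
            S = {x. (\<forall>f\<in>F. f x = 0) \<and> (\<forall>g\<in>G. g x < 0)})"

definition semialgebraic :: "'a::euclidean_space set \<Rightarrow> bool" where
  "semialgebraic S \<longleftrightarrow>
     (\<exists>\<C>. finite \<C> \<and> (\<forall>B\<in>\<C>. basic_semialgebraic B) \<and> S = \<Union>\<C>)"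

text \<open>
  For semi-algebraic \<open>S\<close>, density, a Lebesgue null complement, and a complement of dimension
  less than that of the space are equivalent, and any one of them may serve to define
  genericity. Here the first two are required together, so that no use of the equivalence
  is hidden in the definition.
\<close>

definition generic :: "'a::euclidean_space set \<Rightarrow> bool" where
  "generic S \<longleftrightarrow> semialgebraic S \<and> closure S = UNIV \<and> - S \<in> null_sets lebesgue"

end

theory Submission
  imports Defs
begin

text \<open>
  Semi-algebraicity: the complement of \<open>R0_tensors\<close> is the projection along \<open>x\<close> of a set of
  pairs \<open>(\<A>, x)\<close> cut out by polynomial sign conditions, so a Tarski--Seidenberg theorem is
  needed. Membership in a semi-algebraic set depends only on the signs of finitely many
  polynomials, and this is the form in which quantifiers are eliminated, one variable at a time,
  by Hoermander's method: the signs of finitely many polynomials in the parameters determine the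
  sign diagram of a family of univariate polynomials up to an increasing bijection of the line.

  Null complement: a nonzero solution of \<open>TCP(\<A>, 0)\<close> with support \<open>\<alpha>\<close> satisfies
  \<open>|\<alpha>|\<close> equations linear in \<open>\<A>\<close>, while up to scaling it has only \<open>|\<alpha>| - 1\<close> parameters. Hence the
  bad tensors lie in finitely many polynomial images of hyperplanes. Density follows.
\<close>

subsection \<open>Cells of a finite set of reals\<close>

definition cell :: "real set \<Rightarrow> real \<Rightarrow> real set" where
  "cell Z t = {s. \<forall>z\<in>Z. sgn (s - z) = sgn (t - z)}"

lemma self_in_cell [simp]: "t \<in> cell Z t"
  by (simp add: cell_def)

lemma cell_eq: "s \<in> cell Z t \<Longrightarrow> cell Z s = cell Z t"
  by (auto simp: cell_def)

lemma cell_not_in: "s \<in> cell Z t \<Longrightarrow> t \<notin> Z \<Longrightarrow> s \<notin> Z"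
  unfolding cell_def by (metis (mono_tags, lifting) mem_Collect_eq diff_self eq_iff_diff_eq_0 sgn_zero_iff)

lemma cell_convex:
  assumes "u \<in> cell Z t" "v \<in> cell Z t" "u \<le> x" "x \<le> v"
  shows "x \<in> cell Z t"
  unfolding cell_def
proof (intro CollectI ballI)
  fix z assume "z \<in> Z"
  with assms have "sgn (u - z) = sgn (t - z)" "sgn (v - z) = sgn (t - z)" by (auto simp: cell_def)
  with assms show "sgn (x - z) = sgn (t - z)" by (auto simp: sgn_real_def split: if_splits)
qed

lemma cell_open:
  assumes "finite Z" "t \<notin> Z"
  obtains u v where "u \<in> cell Z t" "v \<in> cell Z t" "u < t" "t < v"
proof -
  obtain d where d: "d > 0" "\<And>z. z \<in> Z \<Longrightarrow> z \<noteq> t \<Longrightarrow> d \<le> dist t z"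
    using finite_set_avoid[OF assms(1), of t] by blast
  have "s \<in> cell Z t" if "\<bar>s - t\<bar> < d" for s
    unfolding cell_def
  proof (intro CollectI ballI)
    fix z assume "z \<in> Z"
    with assms have "d \<le> \<bar>t - z\<bar>" using d(2)[of z] by (auto simp: dist_real_def)
    with that d show "sgn (s - z) = sgn (t - z)"
      by (auto simp: sgn_real_def)
  qed
  from this[of "t - d/2"] this[of "t + d/2"] d(1) that show ?thesis by auto
qed

lemma strict_mono_sgn:
  fixes f :: "real \<Rightarrow> real"
  assumes "strict_mono f" shows "sgn (f x - f y) = sgn (x - y)"
  using strict_mono_less[OF assms, of x y] strict_mono_less[OF assms, of y x]
  by (cases x y rule: linorder_cases) auto

lemma cell_image_iff:
  "strict_mono f \<Longrightarrow> f s \<in> cell (f ` Z) (f t) \<longleftrightarrow> s \<in> cell Z t"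
  by (simp add: cell_def strict_mono_sgn)

lemma sgn_poly_cell:
  assumes "p = 0 \<or> {t. poly p t = 0} \<subseteq> Z" "s \<in> cell Z t"
  shows "sgn (poly p s) = sgn (poly p t)"
proof (cases "p = 0")
  case False
  have *: "sgn (poly p u) = sgn (poly p v)" if "u < v" "u \<in> cell Z t" "v \<in> cell Z t" for u v
  proof (rule ccontr)
    assume ne: "sgn (poly p u) \<noteq> sgn (poly p v)"
    have "\<exists>z. u \<le> z \<and> z \<le> v \<and> poly p z = 0"
    proof (cases "poly p u = 0 \<or> poly p v = 0")
      case True then show ?thesis using \<open>u < v\<close> by (meson less_imp_le order_refl)
    next
      case False
      then have "poly p u * poly p v < 0" using ne
        by (auto simp: sgn_real_def mult_less_0_iff split: if_splits)
      from poly_IVT[OF \<open>u < v\<close> this] show ?thesis by (meson less_imp_le)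
    qed
    then obtain z where z: "u \<le> z" "z \<le> v" "z \<in> Z" using assms(1) False by auto
    with that show False by (force simp: cell_def sgn_real_def split: if_splits)
  qed
  show ?thesis
    using *[of s t] *[of t s] assms(2) self_in_cell by (metis linorder_less_linear)
qed simp

lemma sgn_poly_diff_cell:
  assumes "pderiv p = 0 \<or> {t. poly (pderiv p) t = 0} \<subseteq> Z" "u \<in> cell Z t" "v \<in> cell Z t"
  shows "sgn (poly p v - poly p u) = sgn (v - u) * sgn (poly (pderiv p) t)"
proof -
  have *: "sgn (poly p v - poly p u) = sgn (v - u) * sgn (poly (pderiv p) t)"
    if uv: "u < v" "u \<in> cell Z t" "v \<in> cell Z t" for u v
  proof -
    obtain x where x: "u < x" "x < v" "poly p v - poly p u = (v - u) * poly (pderiv p) x"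
      using poly_MVT[OF uv(1)] by blast
    then have "x \<in> cell Z t" using uv cell_convex[of u Z t v x] by auto
    from sgn_poly_cell[OF assms(1) this] x show ?thesis by (simp add: sgn_mult)
  qed
  show ?thesis
    using *[of u v] *[of v u] assms(2,3)
    by (cases u v rule: linorder_cases)
       (auto simp: sgn_if split: if_splits)
qed

lemma cell_right_unbounded:
  assumes "\<And>z. z \<in> Z \<Longrightarrow> z < t" "t \<le> s"
  shows "s \<in> cell Z t"
  unfolding cell_def
proof (intro CollectI ballI)
  fix z assume "z \<in> Z"
  from assms(1)[OF this] assms(2) show "sgn (s - z) = sgn (t - z)" by simp
qed

lemma pos_attained_iff:
  assumes Z: "finite Z" "t \<notin> Z" "{t. poly (pderiv p) t = 0} \<subseteq> Z"
    and pos: "poly (pderiv p) t > 0"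
  shows "(\<exists>s\<in>cell Z t. poly p s > 0) \<longleftrightarrow>
         (\<forall>z\<in>Z. t < z \<and> (\<forall>y\<in>Z. t < y \<longrightarrow> z \<le> y) \<longrightarrow> poly p z > 0)"
proof (cases "\<exists>z\<in>Z. t < z")
  case False
  then have lt: "\<And>z. z \<in> Z \<Longrightarrow> z < t" using Z(2) by (metis linorder_less_linear)
  have cellI: "s \<in> cell Z t" if "t \<le> s" for s using cell_right_unbounded lt that by blast
  have "pderiv p \<noteq> 0" using pos by auto
  have "lead_coeff (pderiv p) > 0"
  proof (rule ccontr)
    assume "\<not> lead_coeff (pderiv p) > 0"
    then have "lead_coeff (- pderiv p) > 0" using \<open>pderiv p \<noteq> 0\<close>
      by (simp add: order_less_le)
    from poly_pinfty_gt_lc[OF this] obtain n where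
      n: "\<forall>x\<ge>n. poly (- pderiv p) x \<ge> lead_coeff (- pderiv p)" by blast
    have "poly (- pderiv p) (max n t) > 0"
      using n \<open>lead_coeff (- pderiv p) > 0\<close> by (meson less_le_trans max.cobounded1)
    moreover have "sgn (poly (pderiv p) (max n t)) = sgn (poly (pderiv p) t)"
      using sgn_poly_cell[of "pderiv p" Z "max n t" t] Z(3) cellI by simp
    ultimately show False using pos by (simp add: sgn_real_def split: if_splits)
  qed
  then have "lead_coeff p > 0"
  proof -
    have "degree p \<noteq> 0" using \<open>pderiv p \<noteq> 0\<close> pderiv_eq_0_iff by blast
    then have "coeff (pderiv p) (degree (pderiv p)) = of_nat (degree p) * lead_coeff p"
      by (simp add: coeff_pderiv degree_pderiv)
    with \<open>lead_coeff (pderiv p) > 0\<close> show ?thesis by (simp add: zero_less_mult_iff)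
  qed
  from poly_pinfty_gt_lc[OF this] obtain n where "\<forall>x\<ge>n. poly p x \<ge> lead_coeff p" by blast
  then have "poly p (max n t) > 0" using \<open>lead_coeff p > 0\<close> by (meson less_le_trans max.cobounded1)
  moreover have "max n t \<in> cell Z t" by (simp add: cellI)
  ultimately show ?thesis using False by blast
next
  case True
  define z where "z = Min {z\<in>Z. t < z}"
  have fin: "finite {z\<in>Z. t < z}" using Z(1) by simp
  have "z \<in> {z\<in>Z. t < z}" unfolding z_def using True by (intro Min_in[OF fin]) auto
  then have z: "z \<in> Z" "t < z" "\<And>y. y \<in> Z \<Longrightarrow> t < y \<Longrightarrow> z \<le> y"
    using Min_le[OF fin] by (auto simp: z_def)
  have cellI: "s \<in> cell Z t" if "t \<le> s" "s < z" for s
    unfolding cell_def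
  proof (intro CollectI ballI)
    fix y assume "y \<in> Z"
    then consider "y < t" | "z \<le> y" using z(3)[of y] Z(2) by force
    then show "sgn (s - y) = sgn (t - y)" using that z(2) by cases (auto simp: sgn_real_def)
  qed
  have mono: "poly p s < poly p z" if "s \<in> cell Z t" for s
  proof -
    have "s < z" using that z(1,2) by (force simp: cell_def sgn_real_def split: if_splits)
    then obtain x where x: "s < x" "x < z" "poly p z - poly p s = (z - s) * poly (pderiv p) x"
      using poly_MVT by blast
    have "x \<in> cell Z t"
    proof (cases "t \<le> x")
      case True then show ?thesis using cellI x by auto
    next
      case False then show ?thesis using cell_convex[of s Z t t x] that x by auto
    qed
    then have "poly (pderiv p) x > 0"
      using sgn_poly_cell[of "pderiv p" Z x t] Z(3) pos by (simp add: sgn_real_def split: if_splits)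
    with x \<open>s < z\<close> show ?thesis by (metis diff_gt_0_iff_gt zero_less_mult_iff)
  qed
  have "(\<exists>s\<in>cell Z t. poly p s > 0) \<longleftrightarrow> poly p z > 0"
  proof
    assume "poly p z > 0"
    have "((poly p) \<longlongrightarrow> poly p z) (at_left z)"
      using poly_DERIV[of p z, THEN DERIV_isCont] by (simp add: isCont_def filterlim_at_split)
    then have "\<forall>\<^sub>F s in at_left z. poly p s > 0" using \<open>poly p z > 0\<close> order_tendstoD(1) by blast
    moreover have "\<forall>\<^sub>F s in at_left z. s \<in> {t<..<z}"
      using eventually_at_left_real[OF z(2)] .
    ultimately have "\<forall>\<^sub>F s in at_left z. poly p s > 0 \<and> s \<in> {t<..<z}"
      by (rule eventually_conj)
    then obtain s where "poly p s > 0 \<and> s \<in> {t<..<z}"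
      using eventually_happens[of _ "at_left z"] by (auto simp: trivial_limit_at_left_real)
    then show "\<exists>s\<in>cell Z t. poly p s > 0" using cellI[of s] by auto
  qed (use mono in force)
  moreover have "(\<forall>y\<in>Z. t < y \<and> (\<forall>x\<in>Z. t < x \<longrightarrow> y \<le> x) \<longrightarrow> poly p y > 0) \<longleftrightarrow> poly p z > 0"
    using z by (metis order_antisym)
  ultimately show ?thesis by simp
qed

lemma pos_attained_transfer:
  assumes Z: "finite Z" "t \<notin> Z" and \<phi>: "strict_mono \<phi>"
    and p: "{t. poly (pderiv p) t = 0} \<subseteq> Z" "poly (pderiv p) t > 0"
    and q: "{t. poly (pderiv q) t = 0} \<subseteq> \<phi> ` Z" "poly (pderiv q) (\<phi> t) > 0"
    and eq: "\<And>z. z \<in> Z \<Longrightarrow> sgn (poly p z) = sgn (poly q (\<phi> z))"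
  shows "(\<exists>s\<in>cell Z t. poly p s > 0) \<longleftrightarrow> (\<exists>s\<in>cell (\<phi> ` Z) (\<phi> t). poly q s > 0)"
proof -
  have "\<phi> t \<notin> \<phi> ` Z" using Z(2) \<phi> by (metis imageE strict_mono_eq)
  moreover have "poly p z > 0 \<longleftrightarrow> poly q (\<phi> z) > 0" if "z \<in> Z" for z
    using eq[OF that] by (metis sgn_1_pos)
  ultimately show ?thesis
    using Z p q
    by (simp add: pos_attained_iff strict_mono_less[OF \<phi>] strict_mono_less_eq[OF \<phi>])
qed

lemma neg_attained_transfer:
  assumes Z: "finite Z" "t \<notin> Z" and \<phi>: "strict_mono \<phi>"
    and p: "{t. poly (pderiv p) t = 0} \<subseteq> Z" "poly (pderiv p) t > 0"
    and q: "{t. poly (pderiv q) t = 0} \<subseteq> \<phi> ` Z" "poly (pderiv q) (\<phi> t) > 0"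
    and eq: "\<And>z. z \<in> Z \<Longrightarrow> sgn (poly p z) = sgn (poly q (\<phi> z))"
  shows "(\<exists>s\<in>cell Z t. poly p s < 0) \<longleftrightarrow> (\<exists>s\<in>cell (\<phi> ` Z) (\<phi> t). poly q s < 0)"
proof -
  define r :: "real poly \<Rightarrow> real poly" where "r p = - pcompose p [:0, -1:]" for p
  define \<phi>' where "\<phi>' x = - \<phi> (- x)" for x
  have r: "poly (r p) x = - poly p (- x)" "poly (pderiv (r p)) x = poly (pderiv p) (- x)" for p x
    by (auto simp: r_def poly_pcompose pderiv_minus pderiv_pcompose pderiv_pCons)
  have cell: "s \<in> cell (uminus ` Z) t \<longleftrightarrow> - s \<in> cell Z (- t)" for s t Z
  proof -
    have "sgn (s + z) = sgn (t + z) \<longleftrightarrow> sgn (- s - z) = sgn (- t - z)" for z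
      by (auto simp: sgn_real_def)
    then show ?thesis by (simp add: cell_def)
  qed
  have ex: "(\<exists>s\<in>cell (uminus ` Z) (- t). poly (r p) s > 0) \<longleftrightarrow> (\<exists>s\<in>cell Z t. poly p s < 0)" for Z t p
  proof -
    have "(\<exists>s. s \<in> cell (uminus ` Z) (- t) \<and> poly (r p) s > 0) \<longleftrightarrow> (\<exists>s. s \<in> cell Z t \<and> poly p s < 0)"
      by (rule iffI; erule exE; rule_tac x = "- s" in exI) (auto simp: cell r)
    then show ?thesis by blast
  qed
  have im: "\<phi>' ` uminus ` Z = uminus ` \<phi> ` Z" by (auto simp: \<phi>'_def image_image)
  have "(\<exists>s\<in>cell (uminus ` Z) (- t). poly (r p) s > 0) \<longleftrightarrow>
        (\<exists>s\<in>cell (\<phi>' ` uminus ` Z) (\<phi>' (- t)). poly (r q) s > 0)"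
  proof (rule pos_attained_transfer)
    show "strict_mono \<phi>'" using \<phi> by (simp add: \<phi>'_def strict_mono_def)
    show "{t. poly (pderiv (r p)) t = 0} \<subseteq> uminus ` Z"
      using p(1) by (force simp: r)
    show "{t. poly (pderiv (r q)) t = 0} \<subseteq> \<phi>' ` uminus ` Z"
      unfolding im using q(1) by (force simp: r)
    show "sgn (poly (r p) z) = sgn (poly (r q) (\<phi>' z))" if "z \<in> uminus ` Z" for z
      using that eq by (auto simp: r \<phi>'_def sgn_minus)
  qed (use Z p q in \<open>auto simp: r \<phi>'_def\<close>)
  moreover have "\<phi>' (- t) = - \<phi> t" by (simp add: \<phi>'_def)
  ultimately show ?thesis by (simp only: im ex)
qed

lemma sgn_attained_transfer:
  assumes Z: "finite Z" "t \<notin> Z" and \<phi>: "strict_mono \<phi>"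
    and p: "{t. poly (pderiv p) t = 0} \<subseteq> Z"
    and q: "{t. poly (pderiv q) t = 0} \<subseteq> \<phi> ` Z" "sgn (poly (pderiv q) (\<phi> t)) = sgn (poly (pderiv p) t)"
    and eq: "\<And>z. z \<in> Z \<Longrightarrow> sgn (poly p z) = sgn (poly q (\<phi> z))"
    and "\<sigma> \<noteq> 0"
  shows "(\<exists>s\<in>cell Z t. sgn (poly p s) = \<sigma>) \<longleftrightarrow> (\<exists>s\<in>cell (\<phi> ` Z) (\<phi> t). sgn (poly q s) = \<sigma>)"
proof -
  consider "\<sigma> = 1" | "\<sigma> = -1" | "\<sigma> \<noteq> 1" "\<sigma> \<noteq> -1" by blast
  note \<sigma>_cases = this
  have never: "sgn x \<noteq> \<sigma>" if "\<sigma> \<noteq> 1" "\<sigma> \<noteq> -1" for x :: real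
    using that \<open>\<sigma> \<noteq> 0\<close> by (auto simp: sgn_real_def)
  have "poly (pderiv p) t \<noteq> 0" using p Z(2) by auto
  then consider "poly (pderiv p) t > 0" "poly (pderiv q) (\<phi> t) > 0"
    | "poly (pderiv (- p)) t > 0" "poly (pderiv (- q)) (\<phi> t) > 0"
    using q(2) by (auto simp: sgn_real_def pderiv_minus split: if_splits)
  then show ?thesis
  proof cases
    case 1
    note pos_attained_transfer[OF Z \<phi> p 1(1) q(1) 1(2) eq]
      neg_attained_transfer[OF Z \<phi> p 1(1) q(1) 1(2) eq]
    then show ?thesis by (cases rule: \<sigma>_cases) (simp_all add: sgn_1_pos sgn_1_neg never)
  next
    case 2
    have p': "{t. poly (pderiv (- p)) t = 0} \<subseteq> Z" and q': "{t. poly (pderiv (- q)) t = 0} \<subseteq> \<phi> ` Z"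
      and eq': "\<And>z. z \<in> Z \<Longrightarrow> sgn (poly (- p) z) = sgn (poly (- q) (\<phi> z))"
      using p q eq by (auto simp: pderiv_minus sgn_minus)
    note pos_attained_transfer[OF Z \<phi> p' 2(1) q' 2(2) eq']
      neg_attained_transfer[OF Z \<phi> p' 2(1) q' 2(2) eq']
    then show ?thesis by (cases rule: \<sigma>_cases) (simp_all add: sgn_1_pos sgn_1_neg never)
  qed
qed

subsection \<open>Increasing bijections matching sign diagrams\<close>

lemma bump:
  fixes a b u v :: real
  assumes "a < u" "u < b" "a < v" "v < b"
  obtains \<eta> where "strict_mono \<eta>" "surj \<eta>" "\<eta> u = v" "\<And>x. x \<le> a \<or> b \<le> x \<Longrightarrow> \<eta> x = x"
proof -
  define \<eta> where "\<eta> u v x = (if x \<le> a \<or> b \<le> x then x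
      else if x \<le> u then a + (x - a) * ((v - a) / (u - a))
      else b - (b - x) * ((b - v) / (b - u)))" for u v x :: real
  have bd: "(x \<le> u \<longrightarrow> a < \<eta> u v x \<and> \<eta> u v x \<le> v) \<and> (u < x \<longrightarrow> v < \<eta> u v x \<and> \<eta> u v x < b)"
    if "a < u" "u < b" "a < v" "v < b" "a < x" "x < b" for u v x
  proof (intro conjI impI)
    define k where "k = (v - a) / (u - a)"
    have k: "k > 0" "(u - a) * k = v - a" using that by (auto simp: k_def)
    assume "x \<le> u"
    then have \<eta>: "\<eta> u v x = a + (x - a) * k" using that by (simp add: \<eta>_def k_def)
    show "a < \<eta> u v x" using \<eta> k that by simp
    have "(x - a) * k \<le> (u - a) * k" using \<open>x \<le> u\<close> k by (intro mult_right_mono) auto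
    with \<eta> k show "\<eta> u v x \<le> v" by simp
  next
    define k where "k = (b - v) / (b - u)"
    have k: "k > 0" "(b - u) * k = b - v" using that by (auto simp: k_def)
    assume "u < x"
    then have \<eta>: "\<eta> u v x = b - (b - x) * k" using that by (simp add: \<eta>_def k_def)
    show "\<eta> u v x < b" using \<eta> k that by simp
    have "(b - x) * k < (b - u) * k" using \<open>u < x\<close> k by (intro mult_strict_right_mono) auto
    with \<eta> k show "v < \<eta> u v x" by simp
  qed
  have inv: "\<eta> v u (\<eta> u v x) = x" if "a < u" "u < b" "a < v" "v < b" for u v x
  proof (cases "a < x \<and> x < b")
    case True
    with bd[OF that, of x] that show ?thesis
      by (cases "x \<le> u") (auto simp: \<eta>_def mult_le_0_iff divide_le_0_iff)
  next
    case False
    then show ?thesis by (auto simp: \<eta>_def)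
  qed
  have mono: "strict_mono (\<eta> u v)"
  proof (rule strict_monoI)
    fix x y :: real assume "x < y"
    consider "x \<le> a \<or> b \<le> x" | "y \<le> a \<or> b \<le> y" | "a < x" "x < b" "a < y" "y < b" by linarith
    then show "\<eta> u v x < \<eta> u v y"
    proof cases
      case 1
      then have "\<eta> u v x = x" by (auto simp: \<eta>_def)
      moreover have "\<eta> u v y = y \<or> x \<le> a \<and> a < \<eta> u v y"
        using bd[OF assms, of y] \<open>x < y\<close> 1 assms(3) by (cases "y \<le> u") (auto simp: \<eta>_def)
      ultimately show ?thesis using \<open>x < y\<close> by auto
    next
      case 2
      then have "\<eta> u v y = y" by (auto simp: \<eta>_def)
      moreover have "\<eta> u v x = x \<or> b \<le> y \<and> \<eta> u v x < b"
        using bd[OF assms, of x] \<open>x < y\<close> 2 assms(4) by (cases "x \<le> u") (auto simp: \<eta>_def)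
      ultimately show ?thesis using \<open>x < y\<close> by auto
    next
      case 3
      consider "y \<le> u" | "x \<le> u" "u < y" | "u < x" by linarith
      then show ?thesis
      proof cases
        case 1 
        have "(x - a) * ((v - a) / (u - a)) < (y - a) * ((v - a) / (u - a))"
          using \<open>x < y\<close> assms by (intro mult_strict_right_mono) auto
        with 1 3 \<open>x < y\<close> show ?thesis by (auto simp: \<eta>_def)
      next
        case 2 with 3 bd[OF assms, of x] bd[OF assms, of y] show ?thesis by auto
      next
        case right: 3
        have "(b - y) * ((b - v) / (b - u)) < (b - x) * ((b - v) / (b - u))"
          using \<open>x < y\<close> assms by (intro mult_strict_right_mono) auto
        with 3 right \<open>x < y\<close> show ?thesis by (auto simp: \<eta>_def)
      qed
    qed
  qed
  have "surj (\<eta> u v)"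
    by (rule surjI[of _ "\<eta> v u"]) (use inv assms in auto)
  moreover have "\<eta> u v u = v" using assms by (auto simp: \<eta>_def)
  ultimately show ?thesis using that[of "\<eta> u v"] mono by (auto simp: \<eta>_def)
qed

lemma poly_root_between_signs:
  fixes u v :: real
  assumes "sgn (poly p u) = 1" "sgn (poly p v) = -1" "u \<in> cell Z t" "v \<in> cell Z t"
  obtains z where "z \<in> cell Z t" "poly p z = 0"
proof -
  have uv: "poly p u > 0" "poly p v < 0" using assms by (auto simp: sgn_1_pos sgn_1_neg)
  then consider "u < v" | "v < u" by (metis linorder_less_linear order_less_asym)
  then have "\<exists>z. (u \<le> z \<and> z \<le> v \<or> v \<le> z \<and> z \<le> u) \<and> poly p z = 0"
  proof cases
    case 1 then show ?thesis using poly_IVT_neg[of u v p] uv by (meson less_imp_le)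
  next
    case 2 then show ?thesis using poly_IVT_pos[of v u p] uv by (meson less_imp_le)
  qed
  then show ?thesis using that cell_convex assms(3,4) by blast
qed

text \<open>Given a change of variable matching the signs of \<open>p'\<close> and the signs of \<open>p\<close> at the
  points of \<open>Z\<close>, the zeros of \<open>p\<close> and \<open>q\<close> lie in corresponding cells; pushing them onto each
  other one cell at a time produces \<open>\<psi>\<close>.\<close>

lemma sgn_poly_extend:
  fixes p q :: "real poly"
  assumes Z: "finite Z" and \<phi>: "strict_mono \<phi>" "surj \<phi>"
    and p: "pderiv p \<noteq> 0" "{t. poly (pderiv p) t = 0} \<subseteq> Z"
    and q: "{t. poly (pderiv q) t = 0} \<subseteq> \<phi> ` Z"
    and deriv: "\<And>t. sgn (poly (pderiv p) t) = sgn (poly (pderiv q) (\<phi> t))"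
    and eq: "\<And>z. z \<in> Z \<Longrightarrow> sgn (poly p z) = sgn (poly q (\<phi> z))"
  obtains \<psi> where "strict_mono \<psi>" "surj \<psi>" "\<And>z. z \<in> Z \<Longrightarrow> \<psi> z = \<phi> z"
    "\<And>t. sgn (poly p t) = sgn (poly q (\<psi> t))"
proof -
  let ?Z = "\<phi> ` Z"
  have notin: "\<phi> t \<notin> ?Z" if "t \<notin> Z" for t
    using that by (auto simp: strict_mono_eq[OF \<phi>(1)])
  have attained: "(\<exists>s\<in>cell Z t. sgn (poly p s) = \<sigma>) \<longleftrightarrow> (\<exists>s\<in>cell ?Z (\<phi> t). sgn (poly q s) = \<sigma>)"
    if "t \<notin> Z" "\<sigma> \<noteq> 0" for t \<sigma>
    using sgn_attained_transfer[OF Z that(1) \<phi>(1) p(2) q _ eq that(2)] deriv by simp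
  have diff_p: "sgn (poly p v - poly p u) = sgn (v - u) * sgn (poly (pderiv p) t)"
    if "u \<in> cell Z t" "v \<in> cell Z t" for u v t
    using sgn_poly_diff_cell that p by blast
  have diff_q: "sgn (poly q v - poly q u) = sgn (v - u) * sgn (poly (pderiv p) t)"
    if "u \<in> cell ?Z (\<phi> t)" "v \<in> cell ?Z (\<phi> t)" for u v t
    using sgn_poly_diff_cell[OF disjI2[OF q] that] by (simp add: deriv)
  have both: "\<exists>s\<in>cell Y w. sgn (poly r s) = \<sigma>"
    if w: "finite Y" "w \<notin> Y" "poly r w = 0" "{t. poly (pderiv r) t = 0} \<subseteq> Y" "\<sigma> \<in> {1, -1}"
    for Y w r and \<sigma> :: real
  proof -
    obtain u v where uv: "u \<in> cell Y w" "v \<in> cell Y w" "u < w" "w < v"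
      using cell_open[OF w(1,2)] by blast
    have "sgn (poly r u) = - sgn (poly (pderiv r) w)" "sgn (poly r v) = sgn (poly (pderiv r) w)"
      using sgn_poly_diff_cell[of r Y w w u] sgn_poly_diff_cell[of r Y w w v] uv w(3,4)
      by auto
    moreover have "poly (pderiv r) w \<noteq> 0" using w by auto
    then have "sgn (poly (pderiv r) w) \<in> {1, -1}" by (auto simp: sgn_real_def)
    ultimately show ?thesis using w(5) uv(1,2) by force
  qed
  define W where "W = {z. poly p z = 0 \<and> z \<notin> Z}"
  have "p \<noteq> 0" using p(1) by auto
  then have "finite W" unfolding W_def using poly_roots_finite[of p] by (rule_tac finite_subset) auto
  have unique: "z = z'" if "z \<in> W" "z' \<in> W" "z' \<in> cell Z z" for z z'
  proof -
    have "z \<notin> Z" using that by (auto simp: W_def)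
    then have "poly (pderiv p) z \<noteq> 0" using p(2) by auto
    then show ?thesis using diff_p[of z z z'] that by (auto simp: W_def sgn_zero_iff)
  qed
  have "\<exists>\<psi>. strict_mono \<psi> \<and> surj \<psi> \<and> (\<forall>z\<in>Z. \<psi> z = \<phi> z) \<and> (\<forall>z\<in>D. poly q (\<psi> z) = 0)"
    if "finite D" "D \<subseteq> W" for D
    using that
  proof (induction D rule: finite_induct)
    case empty
    then show ?case using \<phi> by auto
  next
    case (insert z D)
    then obtain \<psi> where \<psi>: "strict_mono \<psi>" "surj \<psi>" "\<And>z. z \<in> Z \<Longrightarrow> \<psi> z = \<phi> z"
      "\<And>z. z \<in> D \<Longrightarrow> poly q (\<psi> z) = 0" by auto
    have im: "\<psi> ` Z = ?Z" using \<psi>(3) by force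
    have z: "z \<notin> Z" "poly p z = 0" "z \<in> W" using insert by (auto simp: W_def)
    have "\<exists>s\<in>cell ?Z (\<phi> z). sgn (poly q s) = \<sigma>" if "\<sigma> \<in> {1, -1}" for \<sigma>
      using attained[OF z(1), of \<sigma>] both[OF Z z(1,2) p(2) that] that by auto
    from this[of 1] this[of "-1"] obtain u v where
      "u \<in> cell ?Z (\<phi> z)" "sgn (poly q u) = 1" "v \<in> cell ?Z (\<phi> z)" "sgn (poly q v) = -1" by auto
    then obtain w where w: "w \<in> cell ?Z (\<phi> z)" "poly q w = 0"
      by (rule_tac poly_root_between_signs)
    have cell: "cell ?Z (\<psi> z) = cell ?Z (\<phi> z)"
      using cell_image_iff[OF \<psi>(1)] cell_image_iff[OF \<phi>(1)] im strict_mono_sgn[OF \<phi>(1)]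
        strict_mono_sgn[OF \<psi>(1)] \<psi>(3)
      by (auto simp: cell_def) (metis)+
    have "\<psi> z \<in> cell ?Z (\<phi> z)" using cell self_in_cell by blast
    define a0 b0 where "a0 = min (\<psi> z) w" and "b0 = max (\<psi> z) w"
    have ab0: "a0 \<in> cell ?Z (\<phi> z)" "b0 \<in> cell ?Z (\<phi> z)"
      using w(1) \<open>\<psi> z \<in> cell ?Z (\<phi> z)\<close> by (auto simp: a0_def b0_def min_def max_def)
    have fin: "finite ?Z" using Z by simp
    obtain a where a: "a \<in> cell ?Z (\<phi> z)" "a < a0"
      using cell_open[OF fin cell_not_in[OF ab0(1) notin[OF z(1)]]] cell_eq[OF ab0(1)] by metis
    obtain b where b: "b \<in> cell ?Z (\<phi> z)" "b0 < b"
      using cell_open[OF fin cell_not_in[OF ab0(2) notin[OF z(1)]]] cell_eq[OF ab0(2)] by metis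
    obtain \<eta> where \<eta>: "strict_mono \<eta>" "surj \<eta>" "\<eta> (\<psi> z) = w" "\<And>x. x \<le> a \<or> b \<le> x \<Longrightarrow> \<eta> x = x"
      using bump[of a "\<psi> z" b w] a(2) b(2) by (auto simp: a0_def b0_def)
    have fixed: "\<eta> x = x" if "x \<notin> cell ?Z (\<phi> z)" for x
      using that cell_convex[OF a(1) b(1), of x] \<eta>(4)[of x] by force
    have "\<eta> (\<psi> y) = \<psi> y" if "y \<in> Z" for y
    proof (rule fixed)
      show "\<psi> y \<notin> cell ?Z (\<phi> z)"
        using cell_not_in[OF _ notin[OF z(1)]] \<psi>(3) that by force
    qed
    moreover have "\<eta> (\<psi> y) = \<psi> y" if "y \<in> D" for y
    proof (rule fixed)
      have "y \<in> W" "y \<noteq> z" using insert that by auto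
      then have "y \<notin> cell Z z" using unique z(3) by blast
      then show "\<psi> y \<notin> cell ?Z (\<phi> z)"
        using cell_image_iff[OF \<psi>(1), of y Z z] im cell by simp
    qed
    ultimately have "strict_mono (\<eta> \<circ> \<psi>) \<and> surj (\<eta> \<circ> \<psi>) \<and> (\<forall>z\<in>Z. (\<eta> \<circ> \<psi>) z = \<phi> z) \<and>
        (\<forall>z\<in>insert z D. poly q ((\<eta> \<circ> \<psi>) z) = 0)"
      using \<psi>(3,4) \<eta>(3) w(2) monotone_on_o[OF \<eta>(1) \<psi>(1)] comp_surj[OF \<psi>(2) \<eta>(2)] by auto
    then show ?case by blast
  qed
  from this[OF \<open>finite W\<close> order_refl] obtain \<psi> where \<psi>: "strict_mono \<psi>" "surj \<psi>"
    "\<And>z. z \<in> Z \<Longrightarrow> \<psi> z = \<phi> z" "\<And>z. z \<in> W \<Longrightarrow> poly q (\<psi> z) = 0" by blast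
  have \<psi>_cell: "\<psi> s \<in> cell ?Z (\<phi> t) \<longleftrightarrow> s \<in> cell Z t" for s t
    using strict_mono_sgn[OF \<phi>(1)] strict_mono_sgn[OF \<psi>(1)] \<psi>(3)
    by (auto simp: cell_def) (metis)+
  have "sgn (poly p t) = sgn (poly q (\<psi> t))" for t
  proof (cases "t \<in> Z")
    case True
    then show ?thesis using eq \<psi>(3) by simp
  next
    case False
    have t: "\<psi> t \<in> cell ?Z (\<phi> t)" by (simp add: \<psi>_cell)
    show ?thesis
    proof (cases "\<exists>z\<in>cell Z t. poly p z = 0")
      case True
      then obtain z where z: "z \<in> cell Z t" "poly p z = 0" by blast
      then have "z \<in> W" using cell_not_in False by (auto simp: W_def)
      then have "poly q (\<psi> z) = 0" "\<psi> z \<in> cell ?Z (\<phi> t)" using \<psi>(4) \<psi>_cell z(1) by auto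
      then show ?thesis
        using diff_p[of z t t] diff_q[of "\<psi> z" t "\<psi> t"] z t strict_mono_sgn[OF \<psi>(1), of t z] by simp
    next
      case no_zero: False
      have no_both: "\<not> ((\<exists>s\<in>cell Z t. sgn (poly p s) = 1) \<and> (\<exists>s\<in>cell Z t. sgn (poly p s) = -1))"
        using no_zero poly_root_between_signs by metis
      have q_att: "sgn (poly q (\<psi> t)) = \<sigma> \<Longrightarrow> \<sigma> \<noteq> 0 \<Longrightarrow> \<exists>s\<in>cell Z t. sgn (poly p s) = \<sigma>" for \<sigma>
        using attained[OF False, of \<sigma>] t by blast
      have "poly q (\<psi> t) \<noteq> 0"
      proof
        assume 0: "poly q (\<psi> t) = 0"
        have "\<psi> t \<notin> ?Z" using cell_not_in[OF t notin[OF False]] .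
        from both[OF _ this 0 q] Z cell_eq[OF t]
        have "\<exists>s\<in>cell ?Z (\<phi> t). sgn (poly q s) = \<sigma>" if "\<sigma> \<in> {1, -1}" for \<sigma> using that by simp
        from this[of 1] this[of "-1"] attained[OF False] no_both show False by auto
      qed
      then have "sgn (poly q (\<psi> t)) = 1 \<or> sgn (poly q (\<psi> t)) = -1" by (auto simp: sgn_real_def)
      moreover have "poly p t \<noteq> 0" using no_zero self_in_cell by blast
      then have "sgn (poly p t) = 1 \<or> sgn (poly p t) = -1" by (auto simp: sgn_real_def)
      ultimately show ?thesis
        using no_both q_att[of 1, OF _ one_neq_zero] q_att[of "-1"] self_in_cell[of t Z]
        by (metis neg_eq_iff_add_eq_0 one_neq_zero add.right_neutral)
    qed
  qed
  with that \<psi> show ?thesis by blast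
qed

definition sgn_matching :: "'i set \<Rightarrow> ('i \<Rightarrow> real poly) \<Rightarrow> ('i \<Rightarrow> real poly) \<Rightarrow> (real \<Rightarrow> real) \<Rightarrow> bool" where
  "sgn_matching I p q \<phi> \<longleftrightarrow> strict_mono \<phi> \<and> surj \<phi> \<and>
     (\<forall>i\<in>I. \<forall>t. sgn (poly (p i) t) = sgn (poly (q i) (\<phi> t)))"

lemma sgn_matching_extend:
  assumes I: "finite I" "d \<in> I" and match: "sgn_matching I p q \<phi>"
    and d: "p d = pderiv p0" "q d = pderiv q0" "pderiv p0 \<noteq> 0"
    and roots: "\<And>i t. i \<in> I \<Longrightarrow> p i \<noteq> 0 \<Longrightarrow> poly (p i) t = 0 \<Longrightarrow> sgn (poly p0 t) = sgn (poly q0 (\<phi> t))"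
  obtains \<psi> where "sgn_matching I p q \<psi>" "\<And>t. sgn (poly p0 t) = sgn (poly q0 (\<psi> t))"
proof -
  note \<phi> = match[unfolded sgn_matching_def, THEN conjunct1]
    match[unfolded sgn_matching_def, THEN conjunct2, THEN conjunct1]
    match[unfolded sgn_matching_def, THEN conjunct2, THEN conjunct2, rule_format]
  define Z where "Z = (\<Union>i\<in>{i\<in>I. p i \<noteq> 0}. {t. poly (p i) t = 0})"
  have "finite Z" unfolding Z_def using I(1) poly_roots_finite by auto
  have Z: "p i = 0 \<or> {t. poly (p i) t = 0} \<subseteq> Z" if "i \<in> I" for i
    using that by (auto simp: Z_def)
  have Z': "q i = 0 \<or> {t. poly (q i) t = 0} \<subseteq> \<phi> ` Z" if "i \<in> I" for i
  proof (cases "p i = 0")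
    case True
    have "poly (q i) s = 0" for s
      using \<phi>(3)[OF that] True \<phi>(2) by (metis poly_0 sgn_zero_iff surjD)
    then show ?thesis using poly_all_0_iff_0 by blast
  next
    case False
    have "s \<in> \<phi> ` Z" if s: "poly (q i) s = 0" for s
    proof -
      obtain t where "s = \<phi> t" using \<phi>(2) by (metis surjD)
      with \<phi>(3)[OF \<open>i \<in> I\<close>, of t] s Z[OF \<open>i \<in> I\<close>] False show ?thesis by (auto simp: sgn_zero_iff)
    qed
    then show ?thesis by auto
  qed
  have "pderiv q0 \<noteq> 0"
  proof
    assume "pderiv q0 = 0"
    then have "poly (pderiv p0) t = 0" for t using \<phi>(3)[OF I(2), of t] d by (simp add: sgn_zero_iff)
    then show False using d(3) poly_all_0_iff_0 by blast
  qed
  have "{t. poly (pderiv p0) t = 0} \<subseteq> Z" "{t. poly (pderiv q0) t = 0} \<subseteq> \<phi> ` Z"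
    using Z[OF I(2)] Z'[OF I(2)] d \<open>pderiv q0 \<noteq> 0\<close> by auto
  moreover have "sgn (poly (pderiv p0) t) = sgn (poly (pderiv q0) (\<phi> t))" for t
    using \<phi>(3)[OF I(2)] d by simp
  moreover have "sgn (poly p0 z) = sgn (poly q0 (\<phi> z))" if "z \<in> Z" for z
    using that roots by (auto simp: Z_def)
  ultimately obtain \<psi> where \<psi>: "strict_mono \<psi>" "surj \<psi>" "\<And>z. z \<in> Z \<Longrightarrow> \<psi> z = \<phi> z"
    "\<And>t. sgn (poly p0 t) = sgn (poly q0 (\<psi> t))"
    using sgn_poly_extend[OF \<open>finite Z\<close> \<phi>(1,2) d(3)] by blast
  have "sgn (poly (p i) t) = sgn (poly (q i) (\<psi> t))" if "i \<in> I" for i t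
  proof -
    have "\<psi> t \<in> cell (\<phi> ` Z) (\<phi> t)"
      using strict_mono_sgn[OF \<phi>(1)] strict_mono_sgn[OF \<psi>(1)] \<psi>(3)
      by (auto simp: cell_def) (metis)+
    from sgn_poly_cell[OF Z'[OF that] this] \<phi>(3)[OF that] show ?thesis by simp
  qed
  then show ?thesis using that \<psi> by (auto simp: sgn_matching_def)
qed

subsection \<open>Polynomials with polynomial parameters\<close>

definition param_poly :: "nat \<Rightarrow> ('a::real_normed_vector \<Rightarrow> real poly) \<Rightarrow> bool" where
  "param_poly n p \<longleftrightarrow> (\<forall>k. real_polynomial_function (\<lambda>a. coeff (p a) k)) \<and>
     (\<forall>a. \<forall>k\<ge>n. coeff (p a) k = 0)"

lemma param_poly_mono: "param_poly n p \<Longrightarrow> n \<le> m \<Longrightarrow> param_poly m p"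
  by (auto simp: param_poly_def)

lemma param_poly_coeff: "param_poly n p \<Longrightarrow> real_polynomial_function (\<lambda>a. coeff (p a) k)"
  by (simp add: param_poly_def)

lemma param_poly_pderiv: "param_poly (Suc n) p \<Longrightarrow> param_poly n (\<lambda>a. pderiv (p a))"
  by (auto simp: param_poly_def coeff_pderiv simp del: of_nat_Suc)

lemma param_poly_cutoff:
  assumes "param_poly n p"
  shows "param_poly m (\<lambda>a. poly_cutoff m (p a))"
  unfolding param_poly_def
proof (intro conjI allI impI)
  show "real_polynomial_function (\<lambda>a. coeff (poly_cutoff m (p a)) k)" for k
    using param_poly_coeff[OF assms] real_polynomial_function.intros(2)[of 0]
    by (cases "k < m") (simp_all add: coeff_poly_cutoff)
qed (simp add: coeff_poly_cutoff)

text \<open>Pseudo-division. The coefficient of \<open>q\<close> at \<open>m\<close> is the formal leading coefficient and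
  may vanish for some parameters.\<close>

lemma param_poly_pseudo_mod:
  assumes "param_poly n p" "param_poly (Suc m) q"
  shows "\<exists>r j. param_poly m r \<and>
    (\<forall>a t. poly (q a) t = 0 \<longrightarrow> poly (r a) t = coeff (q a) m ^ j * poly (p a) t)"
  using assms(1)
proof (induction n arbitrary: p)
  case 0
  then have "param_poly m p" using param_poly_mono by blast
  then show ?case by (intro exI[of _ p] exI[of _ 0]) auto
next
  case (Suc n)
  show ?case
  proof (cases "Suc n \<le> m")
    case True
    then have "param_poly m p" using Suc.prems param_poly_mono by blast
    then show ?thesis by (intro exI[of _ p] exI[of _ 0]) auto
  next
    case False
    define p' where "p' a = smult (coeff (q a) m) (p a) - monom (coeff (p a) n) (n - m) * q a" for a
    have "param_poly n p'"
      unfolding param_poly_def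
    proof (intro conjI allI impI)
      fix k
      show "real_polynomial_function (\<lambda>a. coeff (p' a) k)"
        using param_poly_coeff[OF Suc.prems] param_poly_coeff[OF assms(2)]
        by (cases "k < n - m")
          (simp_all add: p'_def coeff_monom_mult real_polynomial_function_diff real_polynomial_function.intros(4))
    next
      fix a k assume "n \<le> k"
      have "coeff (p a) k = 0" if "n < k" using Suc.prems that by (simp add: param_poly_def)
      moreover have "coeff (q a) (k - (n - m)) = 0" if "n < k"
        using assms(2) that False by (simp add: param_poly_def)
      ultimately show "coeff (p' a) k = 0"
        using \<open>n \<le> k\<close> False by (cases "k = n") (auto simp: p'_def coeff_monom_mult)
    qed
    from Suc.IH[OF this] obtain r j where r: "param_poly m r"
      "\<And>a t. poly (q a) t = 0 \<Longrightarrow> poly (r a) t = coeff (q a) m ^ j * poly (p' a) t" by blast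
    then have "\<forall>a t. poly (q a) t = 0 \<longrightarrow> poly (r a) t = coeff (q a) m ^ Suc j * poly (p a) t"
      by (simp add: p'_def)
    with r(1) show ?thesis by blast
  qed
qed

text \<open>Hoermander's method: the sign diagram of a finite family is determined by the signs of
  finitely many polynomials in the parameters. A member \<open>p\<^sub>0\<close> of top degree is traded for its
  derivative and its pseudo-remainders by (truncations of) the other members.\<close>

theorem sgn_matching_param_poly:
  fixes P :: "('a::real_normed_vector \<Rightarrow> real poly) set"
  assumes "finite P" "\<And>p. p \<in> P \<Longrightarrow> param_poly n p"
  shows "\<exists>F. finite F \<and> (\<forall>f\<in>F. real_polynomial_function f) \<and>
    (\<forall>a b. (\<forall>f\<in>F. sgn (f a) = sgn (f b)) \<longrightarrow> (\<exists>\<phi>. sgn_matching P (\<lambda>p. p a) (\<lambda>p. p b) \<phi>))"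
  using assms
proof (induction n arbitrary: P)
  case 0
  then have "p a = 0" if "p \<in> P" for p a
    using that by (auto simp: param_poly_def poly_eq_iff)
  then have "sgn_matching P (\<lambda>p. p a) (\<lambda>p. p b) id" for a b
    unfolding sgn_matching_def by (metis id_apply strict_mono_id surj_id)
  then show ?case by (intro exI[of _ "{}"]) auto
next
  case (Suc n)
  define T where "T P = {p\<in>P. \<not> param_poly n p}" for P :: "('a \<Rightarrow> real poly) set"
  from Suc.prems show ?case
  proof (induction "card (T P)" arbitrary: P)
    case 0
    then have "T P = {}" by (simp add: T_def)
    then have "\<And>p. p \<in> P \<Longrightarrow> param_poly n p" by (auto simp: T_def)
    with Suc.IH[OF "0.prems"(1)] show ?case by blast
  next
    case (Suc k)
    have finT: "finite (T P)" using Suc.prems(1) by (simp add: T_def)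
    obtain p0 where p0: "p0 \<in> T P" using Suc.hyps(2) by fastforce
    then have p0': "p0 \<in> P" "param_poly (Suc n) p0" using Suc.prems by (auto simp: T_def)
    define d where "d a = pderiv (p0 a)" for a
    define I where "I = insert d (P - {p0})"
    have d: "param_poly n d" unfolding d_def using param_poly_pderiv[OF p0'(2)] .
    have I: "param_poly (Suc n) p" if "p \<in> I" for p
      using that d param_poly_mono[OF d, of "Suc n"] Suc.prems(2) by (auto simp: I_def)
    have "finite I" using Suc.prems(1) by (simp add: I_def)
    have "\<forall>q\<in>I. \<forall>m. \<exists>r j. param_poly m r \<and> (\<forall>a t. poly (poly_cutoff (Suc m) (q a)) t = 0 \<longrightarrow>
        poly (r a) t = coeff (poly_cutoff (Suc m) (q a)) m ^ j * poly (p0 a) t)"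
      using param_poly_pseudo_mod[OF p0'(2)] param_poly_cutoff I by blast
    then obtain r j where rj: "\<forall>q\<in>I. \<forall>m. param_poly m (r q m) \<and>
        (\<forall>a t. poly (poly_cutoff (Suc m) (q a)) t = 0 \<longrightarrow>
          poly (r q m a) t = coeff (poly_cutoff (Suc m) (q a)) m ^ j q m * poly (p0 a) t)"
      unfolding bchoice_iff choice_iff by blast
    have r: "param_poly m (r q m)"
      "poly (poly_cutoff (Suc m) (q a)) t = 0 \<Longrightarrow>
         poly (r q m a) t = coeff (q a) m ^ j q m * poly (p0 a) t" if "q \<in> I" for q m a t
      using rj that by (simp_all add: coeff_poly_cutoff)
    define Q where "Q = I \<union> (\<lambda>(q, m). r q m) ` (I \<times> {..n})"
    have "finite Q" using \<open>finite I\<close> by (simp add: Q_def)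
    have rQ: "param_poly n (r q m)" if "q \<in> I" "m \<le> n" for q m
      using r(1)[OF that(1)] that(2) param_poly_mono by blast
    have "T Q = T P - {p0}"
      using rQ d by (auto simp: T_def Q_def I_def)
    then have "card (T Q) = k" using Suc.hyps(2) finT p0 by simp
    moreover have "param_poly (Suc n) p" if "p \<in> Q" for p
      using that I rQ param_poly_mono[of n _ "Suc n"] by (auto simp: Q_def)
    ultimately obtain F where F: "finite F" "\<forall>f\<in>F. real_polynomial_function f"
      "\<And>a b. \<forall>f\<in>F. sgn (f a) = sgn (f b) \<Longrightarrow> \<exists>\<phi>. sgn_matching Q (\<lambda>p. p a) (\<lambda>p. p b) \<phi>"
      using Suc.hyps(1)[of Q] \<open>finite Q\<close> by metis
    define G where "G = (\<lambda>(p, m) a. coeff (p a) m) ` (insert p0 I \<times> {..n})"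
    have "finite (F \<union> G)" using F(1) \<open>finite I\<close> by (simp add: G_def)
    moreover have "\<forall>f\<in>F \<union> G. real_polynomial_function f"
      using F(2) I p0'(2) param_poly_coeff by (fastforce simp: G_def)
    moreover have "\<exists>\<psi>. sgn_matching P (\<lambda>p. p a) (\<lambda>p. p b) \<psi>"
      if ab: "\<forall>f\<in>F \<union> G. sgn (f a) = sgn (f b)" for a b
    proof -
      from ab F(3) obtain \<phi> where \<phi>: "sgn_matching Q (\<lambda>p. p a) (\<lambda>p. p b) \<phi>" by blast
      have coeff: "sgn (coeff (p a) m) = sgn (coeff (p b) m)" if "p \<in> insert p0 I" for p m
      proof (cases "m \<le> n")
        case True
        then have "(\<lambda>a. coeff (p a) m) \<in> G" using that by (force simp: G_def)
        then show ?thesis using bspec[OF ab UnI2] by blast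
      next
        case False
        then show ?thesis using that I p0'(2) by (auto simp: param_poly_def)
      qed
      have \<phi>I: "sgn_matching I (\<lambda>p. p a) (\<lambda>p. p b) \<phi>"
        using \<phi> by (auto simp: sgn_matching_def Q_def)
      obtain \<psi> where \<psi>: "sgn_matching I (\<lambda>p. p a) (\<lambda>p. p b) \<psi>"
        "\<And>t. sgn (poly (p0 a) t) = sgn (poly (p0 b) (\<psi> t))"
      proof (cases "pderiv (p0 a) = 0")
        case True
        have "poly (d b) (\<phi> t) = 0" for t
          using \<phi>I True by (simp add: sgn_matching_def I_def d_def sgn_zero_iff)
        then have "\<forall>t. poly (d b) t = 0" using \<phi>I by (metis sgn_matching_def surjD)
        then have "pderiv (p0 b) = 0" by (simp only: poly_all_0_iff_0 d_def)
        with True obtain c e where "p0 a = [:c:]" "p0 b = [:e:]"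
          by (auto simp: pderiv_eq_0_iff elim!: degree_eq_zeroE)
        then show ?thesis using that[OF \<phi>I] coeff[of p0 0] by simp
      next
        case False
        have roots: "sgn (poly (p0 a) t) = sgn (poly (p0 b) (\<phi> t))"
          if q: "q \<in> I" "q a \<noteq> 0" "poly (q a) t = 0" for q t
        proof -
          define m where "m = degree (q a)"
          have "m \<le> n" using I[OF q(1)] q(2) unfolding m_def param_poly_def
            by (metis leading_coeff_0_iff not_less_eq_eq)
          have ne: "coeff (q a) m \<noteq> 0" using q(2) by (simp add: m_def)
          have "coeff (q a) k = 0" "coeff (q b) k = 0" if "k > m" for k
            using coeff[of q k] q(1) that by (auto simp: m_def coeff_eq_0 sgn_zero_iff)
          then have cut: "poly_cutoff (Suc m) (q a) = q a" "poly_cutoff (Suc m) (q b) = q b"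
            by (auto simp: poly_eq_iff coeff_poly_cutoff)
          have "sgn (poly (q a) t) = sgn (poly (q b) (\<phi> t))"
            using \<phi>I q(1) by (simp add: sgn_matching_def)
          with q(3) have "sgn (poly (q b) (\<phi> t)) = 0" by simp
          then have "poly (q b) (\<phi> t) = 0" by (simp only: sgn_zero_iff)
          then have "sgn (poly (r q m a) t) = sgn (coeff (q a) m) ^ j q m * sgn (poly (p0 a) t)"
            "sgn (poly (r q m b) (\<phi> t)) = sgn (coeff (q b) m) ^ j q m * sgn (poly (p0 b) (\<phi> t))"
            using r(2)[OF q(1), of m a t] r(2)[OF q(1), of m b "\<phi> t"] q(3) cut
            by (simp_all add: sgn_mult)
          moreover have "r q m \<in> Q" using q(1) \<open>m \<le> n\<close> by (force simp: Q_def)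
          then have "sgn (poly (r q m a) t) = sgn (poly (r q m b) (\<phi> t))"
            using \<phi> by (simp add: sgn_matching_def)
          moreover have "sgn (coeff (q a) m) = sgn (coeff (q b) m)" using coeff q(1) by blast
          moreover from this ne have "sgn (coeff (q b) m) \<noteq> 0" by (metis sgn_zero_iff)
          ultimately show ?thesis by auto
        qed
        have "d \<in> I" by (simp add: I_def)
        have "thesis" if "\<And>\<psi>. sgn_matching I (\<lambda>p. p a) (\<lambda>p. p b) \<psi> \<Longrightarrow>
            (\<And>t. sgn (poly (p0 a) t) = sgn (poly (p0 b) (\<psi> t))) \<Longrightarrow> thesis" for thesis
          by (rule sgn_matching_extend[where p = "\<lambda>p. p a" and q = "\<lambda>p. p b",
                OF \<open>finite I\<close> \<open>d \<in> I\<close> \<phi>I d_def[of a] d_def[of b] False roots that])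
        with that show ?thesis by blast
      qed
      then have "sgn_matching P (\<lambda>p. p a) (\<lambda>p. p b) \<psi>"
        by (auto simp: sgn_matching_def I_def)
      then show ?thesis by blast
    qed
    ultimately show ?case by (intro exI[of _ "F \<union> G"]) simp
  qed
qed

subsection \<open>Projections of semi-algebraic sets\<close>

definition sgn_determined :: "('a \<Rightarrow> real) set \<Rightarrow> 'a set \<Rightarrow> bool" where
  "sgn_determined F S \<longleftrightarrow> (\<forall>x y. (\<forall>f\<in>F. sgn (f x) = sgn (f y)) \<longrightarrow> (x \<in> S \<longleftrightarrow> y \<in> S))"

lemma semialgebraic_if_sgn_determined:
  fixes F :: "('a::euclidean_space \<Rightarrow> real) set"
  assumes F: "finite F" "\<And>f. f \<in> F \<Longrightarrow> real_polynomial_function f" and S: "sgn_determined F S"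
  shows "semialgebraic S"
proof -
  define B where "B \<sigma> = {y. \<forall>f\<in>F. sgn (f y) = \<sigma> f}" for \<sigma> :: "('a \<Rightarrow> real) \<Rightarrow> real"
  define sg where "sg x = restrict (\<lambda>f. sgn (f x)) F" for x
  have B: "B (sg x) = {y. \<forall>f\<in>F. sgn (f y) = sgn (f x)}" for x
    by (auto simp: B_def sg_def)
  have sgn_in: "sgn y \<in> {-1, 0, 1}" for y :: real by (auto simp: sgn_real_def)
  have "sg ` S \<subseteq> PiE F (\<lambda>_. {-1, 0, 1})"
    by (intro image_subsetI PiE_I) (use sgn_in in \<open>auto simp: sg_def\<close>)
  then have "finite (sg ` S)" using finite_subset F(1) by (blast intro: finite_PiE)
  then have "finite (B ` sg ` S)" by (rule finite_imageI)
  moreover have "basic_semialgebraic (B (sg x))" for x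
    unfolding basic_semialgebraic_def
  proof (intro exI conjI)
    let ?G = "{f\<in>F. f x < 0} \<union> (\<lambda>f y. - f y) ` {f\<in>F. f x > 0}"
    show "finite {f\<in>F. f x = 0}" "finite ?G" using F(1) by auto
    show "\<forall>f\<in>{f\<in>F. f x = 0} \<union> ?G. real_polynomial_function f"
      using F(2) by (auto intro: real_polynomial_function_minus)
    have "sgn (f y) = sgn (f x) \<longleftrightarrow> (f x = 0 \<longrightarrow> f y = 0) \<and> (f x < 0 \<longrightarrow> f y < 0) \<and> (f x > 0 \<longrightarrow> - f y < 0)"
      for f :: "'a \<Rightarrow> real" and y
      by (auto simp: sgn_real_def)
    then show "B (sg x) = {y. (\<forall>f\<in>{f\<in>F. f x = 0}. f y = 0) \<and> (\<forall>g\<in>?G. g y < 0)}"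
      unfolding B by (auto simp: ball_Un)
  qed
  moreover have "S = \<Union> (B ` sg ` S)"
  proof (intro equalityI subsetI)
    fix y assume "y \<in> \<Union> (B ` sg ` S)"
    then obtain x where "x \<in> S" "\<forall>f\<in>F. sgn (f y) = sgn (f x)" by (auto simp: B)
    with S show "y \<in> S" unfolding sgn_determined_def by blast
  qed (auto simp: B)
  ultimately show ?thesis unfolding semialgebraic_def by (intro exI[of _ "B ` sg ` S"]) auto
qed

lemma real_polynomial_function_along_line:
  assumes "real_polynomial_function f"
  shows "\<exists>n p. param_poly n p \<and> (\<forall>v t. f (v + t *\<^sub>R e) = poly (p v) t)"
  using assms
proof (induction f rule: real_polynomial_function.induct)
  case (linear f)
  define p where "p v = [:f v, f e:]" for v
  have "real_polynomial_function (\<lambda>a. coeff (p a) k)" for k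
    using real_polynomial_function.intros(1)[OF linear] real_polynomial_function.intros(2)
    by (cases k; cases "k - 1") (auto simp: p_def)
  then have "param_poly 2 p"
    by (auto simp: param_poly_def p_def coeff_pCons split: nat.split)
  moreover have "f (v + t *\<^sub>R e) = poly (p v) t" for v t
    using linear by (simp add: p_def linear_simps)
  ultimately show ?case by blast
next
  case (const c)
  have "param_poly 1 (\<lambda>_. [:c:])"
    by (auto simp: param_poly_def coeff_pCons split: nat.split intro: real_polynomial_function.intros(2))
  then show ?case by (intro exI[of _ 1] exI[of _ "\<lambda>_. [:c:]"]) simp
next
  case (add f g)
  then obtain n p m q where pq: "param_poly n p" "\<And>v t. f (v + t *\<^sub>R e) = poly (p v) t"
    "param_poly m q" "\<And>v t. g (v + t *\<^sub>R e) = poly (q v) t" by blast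
  have "param_poly (max n m) (\<lambda>v. p v + q v)"
    using pq(1,3) by (auto simp: param_poly_def intro: real_polynomial_function.intros(3))
  with pq show ?case by (intro exI[of _ "max n m"] exI[of _ "\<lambda>v. p v + q v"]) simp
next
  case (mult f g)
  then obtain n p m q where pq: "param_poly n p" "\<And>v t. f (v + t *\<^sub>R e) = poly (p v) t"
    "param_poly m q" "\<And>v t. g (v + t *\<^sub>R e) = poly (q v) t" by blast
  have "param_poly (n + m) (\<lambda>v. p v * q v)"
    unfolding param_poly_def
  proof (intro conjI allI impI)
    show "real_polynomial_function (\<lambda>a. coeff (p a * q a) k)" for k
      unfolding coeff_mult using pq(1,3)
      by (intro real_polynomial_function_sum real_polynomial_function.intros(4) param_poly_coeff) auto
    fix a k assume "n + m \<le> k"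
    then have "coeff (p a) i * coeff (q a) (k - i) = 0" for i
      using pq(1,3) by (cases "n \<le> i") (auto simp: param_poly_def)
    then show "coeff (p a * q a) k = 0" unfolding coeff_mult by (intro sum.neutral ballI)
  qed
  with pq show ?case by (intro exI[of _ "n + m"] exI[of _ "\<lambda>v. p v * q v"]) simp
qed

lemma sgn_determined_eliminate_line:
  fixes F :: "('a::real_normed_vector \<Rightarrow> real) set"
  assumes F: "finite F" "\<And>f. f \<in> F \<Longrightarrow> real_polynomial_function f" and S: "sgn_determined F S"
  shows "\<exists>G. finite G \<and> (\<forall>g\<in>G. real_polynomial_function g) \<and>
    sgn_determined G {v. \<exists>t. v + t *\<^sub>R e \<in> S}"
proof -
  obtain n p where np: "\<And>f. f \<in> F \<Longrightarrow> param_poly (n f) (p f)"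
    "\<And>f v t. f \<in> F \<Longrightarrow> f (v + t *\<^sub>R e) = poly (p f v) t"
    using real_polynomial_function_along_line[OF F(2), of _ e] by metis
  have "param_poly (sum n F) (p f)" if "f \<in> F" for f
    using np(1)[OF that] by (rule param_poly_mono) (simp add: F(1) member_le_sum that)
  then obtain G where G: "finite G" "\<forall>g\<in>G. real_polynomial_function g"
    "\<And>a b. \<forall>g\<in>G. sgn (g a) = sgn (g b) \<Longrightarrow> \<exists>\<phi>. sgn_matching (p ` F) (\<lambda>p. p a) (\<lambda>p. p b) \<phi>"
    using sgn_matching_param_poly[of "p ` F" "sum n F"] F(1) by auto
  have "\<exists>t. b + t *\<^sub>R e \<in> S" if ab: "\<forall>g\<in>G. sgn (g a) = sgn (g b)" "a + t *\<^sub>R e \<in> S" for a b t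
  proof -
    obtain \<phi> where "sgn_matching (p ` F) (\<lambda>p. p a) (\<lambda>p. p b) \<phi>" using G(3)[OF ab(1)] by blast
    then have "\<forall>f\<in>F. sgn (f (a + t *\<^sub>R e)) = sgn (f (b + \<phi> t *\<^sub>R e))"
      by (simp add: sgn_matching_def np(2))
    with S ab(2) show ?thesis unfolding sgn_determined_def by blast
  qed
  then have "sgn_determined G {v. \<exists>t. v + t *\<^sub>R e \<in> S}"
    unfolding sgn_determined_def mem_Collect_eq by metis
  with G show ?thesis by blast
qed

lemma sgn_determined_eliminate_span:
  fixes F :: "('a::real_normed_vector \<Rightarrow> real) set"
  assumes "finite B"
    and F: "finite F" "\<And>f. f \<in> F \<Longrightarrow> real_polynomial_function f" and S: "sgn_determined F S"
  shows "\<exists>G. finite G \<and> (\<forall>g\<in>G. real_polynomial_function g) \<and>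
    sgn_determined G {v. \<exists>c. v + (\<Sum>e\<in>B. c e *\<^sub>R e) \<in> S}"
  using assms(1)
proof (induction B rule: finite_induct)
  case empty
  with assms show ?case by auto
next
  case (insert e B)
  let ?T = "{v. \<exists>c. v + (\<Sum>e\<in>B. c e *\<^sub>R e) \<in> S}"
  have "{v. \<exists>c. v + (\<Sum>e\<in>insert e B. c e *\<^sub>R e) \<in> S} = {v. \<exists>t. v + t *\<^sub>R e \<in> ?T}"
  proof (intro set_eqI iffI; clarsimp)
    fix v c assume "v + (\<Sum>e\<in>insert e B. c e *\<^sub>R e) \<in> S"
    then show "\<exists>t c. v + t *\<^sub>R e + (\<Sum>e\<in>B. c e *\<^sub>R e) \<in> S"
      using insert by (intro exI[of _ "c e"] exI[of _ c]) (simp add: add.assoc)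
  next
    fix v t c assume "v + t *\<^sub>R e + (\<Sum>e\<in>B. c e *\<^sub>R e) \<in> S"
    moreover have "(\<Sum>x\<in>B. (c(e := t)) x *\<^sub>R x) = (\<Sum>x\<in>B. c x *\<^sub>R x)"
      using insert by (intro sum.cong) auto
    ultimately show "\<exists>c. v + (\<Sum>e\<in>insert e B. c e *\<^sub>R e) \<in> S"
      using insert by (intro exI[of _ "c(e := t)"]) (simp add: add.assoc)
  qed
  moreover obtain G where "finite G" "\<forall>g\<in>G. real_polynomial_function g" "sgn_determined G ?T"
    using insert.IH by blast
  then have "\<exists>G. finite G \<and> (\<forall>g\<in>G. real_polynomial_function g) \<and>
      sgn_determined G {v. \<exists>t. v + t *\<^sub>R e \<in> ?T}"
    using sgn_determined_eliminate_line[of G ?T e] by blast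
  ultimately show ?case by (simp only:)
qed

theorem sgn_determined_projection:
  fixes S :: "('a::real_normed_vector \<times> 'b::euclidean_space) set"
  assumes F: "finite F" "\<And>f. f \<in> F \<Longrightarrow> real_polynomial_function f" and S: "sgn_determined F S"
  shows "\<exists>G. finite G \<and> (\<forall>g\<in>G. real_polynomial_function g) \<and>
    sgn_determined G {a. \<exists>x. (a, x) \<in> S}"
proof -
  let ?B = "Pair 0 ` (Basis :: 'b set) :: ('a \<times> 'b) set"
  let ?T = "{v. \<exists>c. v + (\<Sum>e\<in>?B. c e *\<^sub>R e) \<in> S}"
  obtain G where G: "finite G" "\<forall>g\<in>G. real_polynomial_function g" "sgn_determined G ?T"
    using sgn_determined_eliminate_span[of ?B F S] F S by auto
  have sum: "(\<Sum>e\<in>?B. c e *\<^sub>R e) = (0, \<Sum>b\<in>Basis. c (0, b) *\<^sub>R b)" for c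
    by (subst sum.reindex) (auto simp: inj_on_def sum_prod)
  have "(\<exists>x. (a, x) \<in> S) \<longleftrightarrow> (a, 0) \<in> ?T" for a
  proof
    assume "\<exists>x. (a, x) \<in> S"
    then obtain x where "(a, x) \<in> S" by blast
    then have "(a, 0) + (\<Sum>e\<in>?B. (x \<bullet> snd e) *\<^sub>R e) \<in> S"
      by (simp add: sum euclidean_representation)
    then show "(a, 0) \<in> ?T" unfolding mem_Collect_eq by (intro exI[of _ "\<lambda>e. x \<bullet> snd e"])
  qed (auto simp: sum)
  then have "sgn_determined ((\<lambda>g a. g (a, 0)) ` G) {a. \<exists>x. (a, x) \<in> S}"
    using G(3) unfolding sgn_determined_def by simp
  moreover have "real_polynomial_function (\<lambda>a. g (a, 0))" if "g \<in> G" for g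
  proof -
    have "polynomial_function (\<lambda>a::'a. (a, 0::'b))"
      by (intro polynomial_function_bounded_linear bounded_linear_Pair bounded_linear_ident bounded_linear_zero)
    from real_polynomial_function_compose[OF this] G(2) that show ?thesis by (auto simp: o_def)
  qed
  ultimately show ?thesis using G(1) by (intro exI[of _ "(\<lambda>g a. g (a, 0)) ` G"]) auto
qed

subsection \<open>Genericity of R0-tensors\<close>

lemma zero_in_TCP_Sol:
  fixes A :: "('m::{finite,linorder}, 'n::finite) tensor"
  assumes "CARD('m) \<ge> 2"
  shows "0 \<in> TCP_Sol A 0"
proof -
  have "tensor_apply A 0 = 0"
    using assms by (simp add: tensor_apply_def vec_eq_iff power_0_left)
  then show ?thesis by (simp add: TCP_Sol_def tensor_form_def)
qed

lemma semialgebraic_R0_tensors: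
  assumes "CARD('m::{finite,linorder}) \<ge> 2"
  shows "semialgebraic (R0_tensors :: ('m, 'n::finite) tensor set)"
proof -
  define S where "S = {(A :: ('m, 'n) tensor, x). x \<noteq> 0 \<and> x \<in> TCP_Sol A 0}"
  define F where "F = range (\<lambda>i (A :: ('m, 'n) tensor, x). x $ i)
    \<union> range (\<lambda>i (A, x). tensor_apply A x $ i) \<union> {\<lambda>(A, x). tensor_form A x}"
  have x: "real_polynomial_function (\<lambda>p :: ('m, 'n) tensor \<times> (real ^ 'n). snd p $ i)" for i
    by (intro real_polynomial_function.intros(1) bounded_linear_compose[OF bounded_linear_vec_nth bounded_linear_snd])
  have A: "real_polynomial_function (\<lambda>p :: ('m, 'n) tensor \<times> (real ^ 'n). fst p $ i)" for i
    by (intro real_polynomial_function.intros(1) bounded_linear_compose[OF bounded_linear_vec_nth bounded_linear_fst])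
  have app: "real_polynomial_function (\<lambda>p :: ('m, 'n) tensor \<times> (real ^ 'n). tensor_apply (fst p) (snd p) $ i)" for i
    unfolding tensor_apply_def vec_lambda_beta
    by (intro real_polynomial_function_sum real_polynomial_function.intros(4) real_polynomial_function_prod x A) auto
  have form: "real_polynomial_function (\<lambda>p :: ('m, 'n) tensor \<times> (real ^ 'n). tensor_form (fst p) (snd p))"
    unfolding tensor_form_def inner_vec_def inner_real_def
    by (intro real_polynomial_function_sum real_polynomial_function.intros(4) x app) auto
  have "finite F" by (simp add: F_def)
  moreover have "real_polynomial_function f" if "f \<in> F" for f
    using that x app form by (auto simp: F_def case_prod_unfold)
  moreover have "sgn_determined F S"
    unfolding sgn_determined_def
  proof (intro allI impI)
    fix p q :: "('m, 'n) tensor \<times> (real ^ 'n)"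
    assume eq: "\<forall>f\<in>F. sgn (f p) = sgn (f q)"
    have S_iff: "p \<in> S \<longleftrightarrow> (\<exists>i. sgn (snd p $ i) \<noteq> 0) \<and> (\<forall>i. sgn (snd p $ i) \<noteq> -1) \<and>
        (\<forall>i. sgn (tensor_apply (fst p) (snd p) $ i) \<noteq> -1) \<and> sgn (tensor_form (fst p) (snd p)) = 0"
      for p :: "('m, 'n) tensor \<times> (real ^ 'n)"
      by (auto simp: S_def TCP_Sol_def case_prod_unfold vec_eq_iff sgn_1_neg sgn_zero_iff not_less)
    have "sgn (snd p $ i) = sgn (snd q $ i)"
      "sgn (tensor_apply (fst p) (snd p) $ i) = sgn (tensor_apply (fst q) (snd q) $ i)"
      "sgn (tensor_form (fst p) (snd p)) = sgn (tensor_form (fst q) (snd q))" for i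
      using eq by (auto simp: F_def case_prod_unfold ball_Un)
    then show "p \<in> S \<longleftrightarrow> q \<in> S" unfolding S_iff by simp
  qed
  ultimately obtain G where G: "finite G" "\<forall>g\<in>G. real_polynomial_function g"
    "sgn_determined G {A. \<exists>x. (A, x) \<in> S}"
    using sgn_determined_projection[of F S] by blast
  have "(0::real ^ 'n) \<in> TCP_Sol A 0" for A :: "('m, 'n) tensor"
    using assms by (rule zero_in_TCP_Sol)
  then have compl: "R0_tensors = - {A :: ('m, 'n) tensor. \<exists>x. (A, x) \<in> S}"
    by (auto simp: R0_tensors_def S_def)
  have "sgn_determined G (R0_tensors :: ('m, 'n) tensor set)"
    using G(3) unfolding compl sgn_determined_def Compl_iff Not_eq_iff .
  with G semialgebraic_if_sgn_determined show ?thesis by blast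
qed

text \<open>Normalising \<open>x\<^bsub>i\<^sub>0\<^esub> = 1\<close>, the equations \<open>(\<A> x\<^sup>m\<^sup>-\<^sup>1)\<^sub>i = 0\<close>, \<open>i \<in> \<alpha>\<close>, determine the entries
  \<open>a\<^bsub>i i\<^sub>0 \<dots> i\<^sub>0\<^esub>\<close> from \<open>x\<close> and the other entries. Storing \<open>x\<^sub>i\<close> in the slot of that entry leaves
  the slot of \<open>a\<^bsub>i\<^sub>0 i\<^sub>0 \<dots> i\<^sub>0\<^esub>\<close> free, so the set is the polynomial image of a hyperplane.\<close>

lemma negligible_supported_kernel:
  fixes \<alpha> :: "'n::finite set" and i0 :: 'n
  assumes "i0 \<in> \<alpha>"
  shows "negligible {A :: ('m::{finite,linorder}, 'n) tensor.
    \<exists>x. (\<forall>i. i \<notin> \<alpha> \<longrightarrow> x $ i = 0) \<and> x $ i0 \<noteq> 0 \<and> (\<forall>i\<in>\<alpha>. tensor_apply A x $ i = 0)}"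
proof -
  define e :: "'n \<Rightarrow> 'm \<Rightarrow> 'n" where "e i j = (if j = first_slot then i else i0)" for i j
  have e: "e i first_slot = i" "j \<noteq> first_slot \<Longrightarrow> e i j = i0" for i j by (auto simp: e_def)
  have e_eq: "e i = e i' \<longleftrightarrow> i = i'" for i i' using e(1) by metis
  define X :: "('m, 'n) tensor \<Rightarrow> real ^ 'n" where
    "X B = (\<chi> i. if i = i0 then 1 else if i \<in> \<alpha> then B $ e i else 0)" for B
  define R :: "('m, 'n) tensor \<Rightarrow> 'n \<Rightarrow> real" where
    "R B i = (\<Sum>\<iota> \<in> {\<iota>. \<iota> first_slot = i} - {e i}. B $ \<iota> * (\<Prod>j \<in> UNIV - {first_slot}. X B $ \<iota> j))" for B i
  define \<Phi> :: "('m, 'n) tensor \<Rightarrow> ('m, 'n) tensor" where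
    "\<Phi> B = (\<chi> \<kappa>. if \<kappa> first_slot \<in> \<alpha> \<and> \<kappa> = e (\<kappa> first_slot) then - R B (\<kappa> first_slot) else B $ \<kappa>)" for B
  have nth: "real_polynomial_function (\<lambda>B :: ('m, 'n) tensor. B $ \<kappa>)" for \<kappa>
    by (intro real_polynomial_function.intros(1) bounded_linear_vec_nth)
  have "real_polynomial_function (\<lambda>B. X B $ i)" for i
    using nth real_polynomial_function.intros(2)
    by (cases "i = i0"; cases "i \<in> \<alpha>") (simp_all add: X_def)
  then have R: "real_polynomial_function (\<lambda>B. R B i)" for i
    unfolding R_def
    by (intro real_polynomial_function_sum real_polynomial_function.intros(4) real_polynomial_function_prod nth) auto
  have "real_polynomial_function (\<lambda>B. \<Phi> B $ \<kappa>)" for \<kappa>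
  proof (cases "\<kappa> first_slot \<in> \<alpha> \<and> \<kappa> = e (\<kappa> first_slot)")
    case True
    then show ?thesis using real_polynomial_function_minus[OF R] by (simp add: \<Phi>_def)
  next
    case False
    show ?thesis using nth by (simp only: \<Phi>_def vec_lambda_beta False if_False)
  qed
  then have "polynomial_function \<Phi>"
    by (auto simp: polynomial_function_iff_Basis_inner Basis_vec_def inner_axis)
  then have "negligible (\<Phi> ` {B. B $ e i0 = 0})"
    by (intro negligible_differentiable_image_negligible differentiable_on_polynomial_function
        negligible_standard_hyperplane_cart) auto
  moreover have "A \<in> \<Phi> ` {B. B $ e i0 = 0}"
    if x: "\<And>i. i \<notin> \<alpha> \<Longrightarrow> x $ i = 0" "x $ i0 \<noteq> 0" "\<And>i. i \<in> \<alpha> \<Longrightarrow> tensor_apply A x $ i = 0" for A x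
  proof
    let ?E = "UNIV - {first_slot :: 'm}"
    define B where "B = (\<chi> \<kappa>. if \<kappa> = e i0 then 0
      else if \<kappa> first_slot \<in> \<alpha> \<and> \<kappa> = e (\<kappa> first_slot) then x $ (\<kappa> first_slot) / x $ i0 else A $ \<kappa>)"
    show "B \<in> {B. B $ e i0 = 0}" by (simp add: B_def)
    have X: "X B $ i = x $ i / x $ i0" for i
      using x by (simp add: X_def B_def e e_eq)
    have R: "R B i = - A $ e i" if "i \<in> \<alpha>" for i
    proof -
      let ?p = "\<lambda>\<iota>. \<Prod>j\<in>?E. x $ \<iota> j / x $ i0"
      have "0 = tensor_apply A x $ i / (x $ i0) ^ card ?E" using x(3)[OF that] by simp
      also have "\<dots> = (\<Sum>\<iota> | \<iota> first_slot = i. A $ \<iota> * ?p \<iota>)"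
        by (simp add: tensor_apply_def sum_divide_distrib prod_dividef)
      also have "\<dots> = A $ e i * ?p (e i) + (\<Sum>\<iota> \<in> {\<iota>. \<iota> first_slot = i} - {e i}. A $ \<iota> * ?p \<iota>)"
        by (rule sum.remove) (auto simp: e)
      also have "?p (e i) = 1" using x(2) by (intro prod.neutral) (auto simp: e)
      also have "(\<Sum>\<iota> \<in> {\<iota>. \<iota> first_slot = i} - {e i}. A $ \<iota> * ?p \<iota>) = R B i"
        unfolding R_def X by (intro sum.cong) (auto simp: B_def e)
      finally show ?thesis by simp
    qed
    show "A = \<Phi> B"
      unfolding vec_eq_iff
    proof
      fix \<kappa>
      show "A $ \<kappa> = \<Phi> B $ \<kappa>"
      proof (cases "\<kappa> first_slot \<in> \<alpha> \<and> \<kappa> = e (\<kappa> first_slot)")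
        case True
        with R[of "\<kappa> first_slot"] show ?thesis by (simp add: \<Phi>_def)
      next
        case False
        then have "\<kappa> \<noteq> e i0" using assms e(1) by auto
        with False show ?thesis by (auto simp: \<Phi>_def B_def)
      qed
    qed
  qed
  then have "{A. \<exists>x. (\<forall>i. i \<notin> \<alpha> \<longrightarrow> x $ i = 0) \<and> x $ i0 \<noteq> 0 \<and> (\<forall>i\<in>\<alpha>. tensor_apply A x $ i = 0)}
      \<subseteq> \<Phi> ` {B. B $ e i0 = 0}"
    by blast
  ultimately show ?thesis by (rule negligible_subset)
qed

lemma negligible_not_R0_tensors:
  assumes "CARD('m::{finite,linorder}) \<ge> 2"
  shows "negligible (- R0_tensors :: ('m, 'n::finite) tensor set)"
proof -
  define K where "K \<alpha> i0 = {A :: ('m, 'n) tensor.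
    \<exists>x. (\<forall>i. i \<notin> \<alpha> \<longrightarrow> x $ i = 0) \<and> x $ i0 \<noteq> 0 \<and> (\<forall>i\<in>\<alpha>. tensor_apply A x $ i = 0)}" for \<alpha> i0
  have "A \<in> (\<Union>(\<alpha>, i0)\<in>{(\<alpha>, i0). i0 \<in> \<alpha>}. K \<alpha> i0)" if "A \<notin> R0_tensors" for A
  proof -
    have "0 \<in> TCP_Sol A 0" using assms by (rule zero_in_TCP_Sol)
    with that obtain x where x: "x \<in> TCP_Sol A 0" "x \<noteq> 0" by (auto simp: R0_tensors_def)
    then have nonneg: "x $ i \<ge> 0" "tensor_apply A x $ i \<ge> 0" for i by (auto simp: TCP_Sol_def)
    have "(\<Sum>i\<in>UNIV. x $ i * tensor_apply A x $ i) = 0"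
      using x(1) by (simp add: TCP_Sol_def tensor_form_def inner_vec_def)
    then have "x $ i * tensor_apply A x $ i = 0" for i
      using nonneg by (subst (asm) sum_nonneg_eq_0_iff) auto
    moreover obtain i0 where "x $ i0 \<noteq> 0" using x(2) by (auto simp: vec_eq_iff)
    ultimately have "A \<in> K {i. x $ i \<noteq> 0} i0" by (auto simp: K_def intro!: exI[of _ x])
    with \<open>x $ i0 \<noteq> 0\<close> show ?thesis by (intro UN_I[of "({i. x $ i \<noteq> 0}, i0)"]) auto
  qed
  then have "- R0_tensors \<subseteq> (\<Union>(\<alpha>, i0)\<in>{(\<alpha>, i0). i0 \<in> \<alpha>}. K \<alpha> i0)" by auto
  moreover have "negligible (K \<alpha> i0)" if "i0 \<in> \<alpha>" for \<alpha> i0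
    unfolding K_def using that by (rule negligible_supported_kernel)
  then have "negligible (\<Union>(\<alpha>, i0)\<in>{(\<alpha>, i0). i0 \<in> \<alpha>}. K \<alpha> i0)"
    by (intro negligible_Union finite_imageI finite) auto
  ultimately show ?thesis using negligible_subset by blast
qed

theorem theorem3p2:
  assumes "CARD('m::{finite,linorder}) \<ge> 2" and "CARD('n::finite) \<ge> 2"
  shows "generic (R0_tensors :: ('m, 'n) tensor set)"
proof -
  have null: "negligible (- R0_tensors :: ('m, 'n) tensor set)"
    using assms(1) by (rule negligible_not_R0_tensors)
  have "- closure R0_tensors \<subseteq> - (R0_tensors :: ('m, 'n) tensor set)"
    using closure_subset by auto
  with null have "negligible (- closure (R0_tensors :: ('m, 'n) tensor set))"
    by (rule negligible_subset)
  then have "closure (R0_tensors :: ('m, 'n) tensor set) = UNIV"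
    using open_not_negligible[of "- closure (R0_tensors :: ('m, 'n) tensor set)"] by auto
  with null semialgebraic_R0_tensors[OF assms(1)] show ?thesis
    by (simp add: generic_def negligible_iff_null_sets)
qed

end
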